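(* Let $\gamma\in(1,5/3]$, $A\in C^2(\mathbf R_+)$ with $A>0$, and $a=A'/A$. Let $\bar a\in C^1_b(\mathbf R_+)\cap L^1(\mathbf R_+)$ and positive constants $L_1,L_2,U_1,U_2$ satisfy $|a(x)|<l\,\bar a(x)$ for all $x\ge0$ and $$U_1e^{2\int_0^\infty\bar a(x)dx}\le L_1,\quad L_2\le U_2,\quad \frac{3-\gamma}{\gamma+1}<\frac{L_2}{L_1},\quad \frac{U_2}{U_1}<\frac{\gamma+1}{3-\gamma},$$ $$\frac{L_1}{L_2}\le\sigma_1,\quad \frac{U_2}{U_1}\le\sigma_1,\quad U_2\ge L_1,\quad U_1\ge L_2 .$$ If $(z_0(x),w_0(x))\in\Delta_{m,x}$ for every $x\ge0$ and (P1) has a smooth solution $(z,w)$ satisfying $\rho\ge0$, then $\Delta_{m,x}$ is an invariant region for (P1): $(z(x,t),w(x,t))\in\Delta_{m,x}$ for every $x\ge0$ and every $t\geq 0$ in the time interval of existence of the solution.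
   Context: Notation: $\mathbf R_+=[0,\infty)$; $C^1_b$ denotes $C^1$ functions that are bounded together with their first derivative. $\theta=(\gamma-1)/2$. The problem comes from the isentropic nozzle flow equations $\rho_t+m_x=-a(x)m$, $m_t+(m^2/\rho+p(\rho))_x=-a(x)m^2/\rho$, $p(\rho)=\rho^\gamma/\gamma$, $v=m/\rho$, via the Riemann invariants $w=v+\rho^\theta/\theta$, $z=v-\rho^\theta/\theta$, so that $v=(w+z)/2$ and $\rho=(\theta(w-z)/2)^{1/\theta}$; thus $\rho\ge0$ means $w\ge z$. The characteristic speeds are $\lambda_1=v-\rho^\theta=\frac{\gamma+1}{4}z+\frac{3-\gamma}{4}w$ and $\lambda_2=v+\rho^\theta=\frac{3-\gamma}{4}z+\frac{\gamma+1}{4}w$. Problem (P1): on $x\ge0$, $t\ge0$, $$z_t+\lambda_1z_x=\tfrac{\gamma-1}{8}a(x)(w^2-z^2),\qquad w_t+\lambda_2w_x=-\tfrac{\gamma-1}{8}a(x)(w^2-z^2),$$ with initial data $(z,w)|_{t=0}=(z_0,w_0)$ and boundary condition $v|_{x=0}=0$, i.e. $(w+z)|_{x=0}=0$. Solutions are considered in the class of bounded $C^1$ functions on $\mathbf R_+\times[0,T]$. Constants $l,\sigma_1$: let $f(r)=\frac{2}{\gamma-1}\,\frac{\gamma+1+(3-\gamma)r}{|r^2-1|}$ (with $f(\pm1)=+\infty$). $l>0$ is the minimum of $f$ on $[-1,1]$; $-\sigma_1$ (with $\sigma_1>1$) is the solution of $f(r)=l$ in $r<-1$. Region: $$\Delta_{m,x}=\Big\{(z,w):-L_1e^{-\int_0^x\bar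 a(y)dy}\le z\le-U_1e^{\int_0^x\bar a(y)dy},\ L_2e^{-\int_0^x\bar a(y)dy}\le w\le U_2e^{\int_0^x\bar a(y)dy},\ w\ge z\Big\}.$$ *)

theory Defs
  imports "HOL-Analysis.Analysis"
begin

(* Derivatives are taken within S, hence one-sided at endpoints of S.  The library's
   C1_differentiable_on requires two-sided derivatives at every point of S, which would refer to
   values outside the half-line. *)
definition C1_on_with :: "real set \<Rightarrow> (real \<Rightarrow> real) \<Rightarrow> (real \<Rightarrow> real) \<Rightarrow> bool" where
  "C1_on_with S f f' \<longleftrightarrow>
     (\<forall>x\<in>S. (f has_real_derivative f' x) (at x within S)) \<and> continuous_on S f'"

definition C2_on_with ::
  "real set \<Rightarrow> (real \<Rightarrow> real) \<Rightarrow> (real \<Rightarrow> real) \<Rightarrow> bool" where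
  "C2_on_with S f f' \<longleftrightarrow> C1_on_with S f f' \<and> (\<exists>f''. C1_on_with S f' f'')"

definition C1b_on :: "real set \<Rightarrow> (real \<Rightarrow> real) \<Rightarrow> bool" where
  "C1b_on S f \<longleftrightarrow> (\<exists>f'. C1_on_with S f f' \<and> bounded (f ` S) \<and> bounded (f' ` S))"

(* Points are pairs (x, t); ux and ut are the partial derivatives of u. *)
definition C1_on_with2 ::
  "(real \<times> real) set \<Rightarrow> (real \<times> real \<Rightarrow> real) \<Rightarrow> (real \<times> real \<Rightarrow> real) \<Rightarrow> (real \<times> real \<Rightarrow> real) \<Rightarrow> bool"
where
  "C1_on_with2 S u ux ut \<longleftrightarrow>
     (\<forall>p\<in>S. (u has_derivative (\<lambda>(h, k). ux p * h + ut p * k)) (at p within S)) \<and>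
     continuous_on S ux \<and> continuous_on S ut"

definition speed1 :: "real \<Rightarrow> real \<Rightarrow> real \<Rightarrow> real" where
  "speed1 \<gamma> z w = (\<gamma> + 1) / 4 * z + (3 - \<gamma>) / 4 * w"

definition speed2 :: "real \<Rightarrow> real \<Rightarrow> real \<Rightarrow> real" where
  "speed2 \<gamma> z w = (3 - \<gamma>) / 4 * z + (\<gamma> + 1) / 4 * w"

(* z and w are the Riemann invariants v - rho^theta / theta and v + rho^theta / theta; hence
   v = (w + z) / 2, and the boundary condition v = 0 reads w + z = 0. *)
definition P1_solution ::
  "real \<Rightarrow> (real \<Rightarrow> real) \<Rightarrow> (real \<Rightarrow> real) \<Rightarrow> (real \<Rightarrow> real) \<Rightarrow> real \<Rightarrow>
   (real \<times> real \<Rightarrow> real) \<Rightarrow> (real \<times> real \<Rightarrow> real) \<Rightarrow> bool"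
where
  "P1_solution \<gamma> a z0 w0 T z w \<longleftrightarrow>
     bounded (z ` ({0..} \<times> {0..T})) \<and> bounded (w ` ({0..} \<times> {0..T})) \<and>
     (\<exists>zx zt wx wt.
        C1_on_with2 ({0..} \<times> {0..T}) z zx zt \<and>
        C1_on_with2 ({0..} \<times> {0..T}) w wx wt \<and>
        (\<forall>x\<ge>0. \<forall>t\<in>{0..T}.
           zt (x, t) + speed1 \<gamma> (z (x, t)) (w (x, t)) * zx (x, t)
             = (\<gamma> - 1) / 8 * a x * ((w (x, t))\<^sup>2 - (z (x, t))\<^sup>2) \<and>
           wt (x, t) + speed2 \<gamma> (z (x, t)) (w (x, t)) * wx (x, t)
             = - ((\<gamma> - 1) / 8 * a x * ((w (x, t))\<^sup>2 - (z (x, t))\<^sup>2)))) \<and>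
     (\<forall>x\<ge>0. z (x, 0) = z0 x \<and> w (x, 0) = w0 x) \<and>
     (\<forall>t\<in>{0..T}. w (0, t) + z (0, t) = 0)"

definition f_ratio :: "real \<Rightarrow> real \<Rightarrow> ereal" where
  "f_ratio \<gamma> r =
     (if r = 1 \<or> r = -1 then \<infinity>
      else ereal (2 / (\<gamma> - 1) * ((\<gamma> + 1 + (3 - \<gamma>) * r) / \<bar>r\<^sup>2 - 1\<bar>)))"

definition is_l :: "real \<Rightarrow> real \<Rightarrow> bool" where
  "is_l \<gamma> l \<longleftrightarrow>
     l > 0 \<and> (\<exists>r\<in>{-1..1}. f_ratio \<gamma> r = ereal l) \<and> (\<forall>r\<in>{-1..1}. ereal l \<le> f_ratio \<gamma> r)"

(* For 1 < gamma < 3, f_ratio decreases from infinity to 0 as r runs from -1 down to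
   -(gamma + 1) / (3 - gamma) and is negative beyond, so s exists and is unique. *)
definition is_sigma1 :: "real \<Rightarrow> real \<Rightarrow> real \<Rightarrow> bool" where
  "is_sigma1 \<gamma> l s \<longleftrightarrow> s > 1 \<and> f_ratio \<gamma> (- s) = ereal l"

definition Delta_m ::
  "(real \<Rightarrow> real) \<Rightarrow> real \<Rightarrow> real \<Rightarrow> real \<Rightarrow> real \<Rightarrow> real \<Rightarrow> (real \<times> real) set"
where
  "Delta_m abar L1 L2 U1 U2 x =
     {(z, w).
        - L1 * exp (- integral {0..x} abar) \<le> z \<and> z \<le> - U1 * exp (integral {0..x} abar) \<and>
        L2 * exp (- integral {0..x} abar) \<le> w \<and> w \<le> U2 * exp (integral {0..x} abar) \<and>
        w \<ge> z}"

end

theory Submission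
  imports Defs
begin

text \<open>
  Write \<open>E x\<close> for the exponential of the integral of \<open>abar\<close> over \<open>[0, x]\<close>.  The four sides of the
  region are the zero sets of \<open>zE + L1\<close>, \<open>-z/E - U1\<close>, \<open>wE - L2\<close> and \<open>U2 - w/E\<close>.  Where one of these
  functions vanishes while the others are nonnegative, its derivative along the characteristic is
  positive: after division by the square of the unknown this is \<open>f r \<ge> l\<close> for the ratio
  \<open>r \<in> [-\<sigma>1, 0]\<close> of the two unknowns, together with \<open>\<bar>a\<bar> < l * abar\<close>.  Hence a first contact is
  impossible at interior points; at \<open>x = 0\<close> a contact of \<open>w\<close> is also one of \<open>z\<close>, whose
  characteristic leaves the domain there.  The speeds are bounded, so it suffices to argue on
  compact truncated cones.  On a cone \<open>\<bar>a\<bar> / abar\<close> stays away from \<open>l\<close>, which leaves room to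
  enlarge the region by \<open>\<delta>\<close>; then the data are strictly inside, and \<open>\<delta>\<close> tends to 0.
\<close>

lemma derivative_along_first_contact:
  fixes u :: "real \<times> real \<Rightarrow> real"
  assumes u: "(u has_derivative (\<lambda>(h, k). ux * h + ut * k)) (at (x, t) within S)"
    and G: "(G has_real_derivative G') (at x within R)"
    and "s0 > 0"
    and S: "\<And>s. 0 \<le> s \<Longrightarrow> s \<le> s0 \<Longrightarrow> (x - \<mu> * s, t - s) \<in> S"
    and R: "\<And>s. 0 \<le> s \<Longrightarrow> s \<le> s0 \<Longrightarrow> x - \<mu> * s \<in> R"
    and nonneg: "\<And>s. 0 < s \<Longrightarrow> s \<le> s0 \<Longrightarrow> 0 \<le> u (x - \<mu> * s, t - s) * G (x - \<mu> * s) + c"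
    and zero: "u (x, t) * G x + c = 0"
  shows "(ut + \<mu> * ux) * G x + \<mu> * u (x, t) * G' \<le> 0"
proof (rule ccontr)
  let ?I = "{0..s0}"
  define \<phi> where "\<phi> s = u (x - \<mu> * s, t - s) * G (x - \<mu> * s) + c" for s
  assume "\<not> ?thesis"
  then have neg: "- ((ut + \<mu> * ux) * G x + \<mu> * u (x, t) * G') < 0" by simp
  have u': "(u has_derivative (\<lambda>(h, k). ux * h + ut * k))
      (at (x - \<mu> * 0, t - 0) within (\<lambda>s. (x - \<mu> * s, t - s)) ` ?I)"
    by (rule has_derivative_subset[of _ _ _ S]) (use u S in auto)
  have du: "((\<lambda>s. u (x - \<mu> * s, t - s)) has_derivative (\<lambda>h. - (ut + \<mu> * ux) * h)) (at 0 within ?I)"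
    by (rule has_derivative_eq_rhs[OF has_derivative_in_compose[OF _ u']])
      (auto intro!: derivative_eq_intros simp: algebra_simps)
  have G'': "(G has_real_derivative G') (at (x - \<mu> * 0) within (\<lambda>s. x - \<mu> * s) ` ?I)"
    by (rule DERIV_subset[of _ _ _ R]) (use G R in auto)
  have "((\<lambda>s. x - \<mu> * s) has_real_derivative - \<mu>) (at 0 within ?I)"
    by (auto intro!: derivative_eq_intros)
  from DERIV_image_chain[OF G'' this]
  have dG: "((\<lambda>s. G (x - \<mu> * s)) has_real_derivative - \<mu> * G') (at 0 within ?I)"
    by (simp add: o_def mult.commute)
  have "(\<phi> has_real_derivative - ((ut + \<mu> * ux) * G x + \<mu> * u (x, t) * G')) (at 0 within ?I)"
    unfolding \<phi>_def
    by (rule derivative_eq_intros du[folded has_field_derivative_def] dG refl)+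
      (simp add: algebra_simps)
  from has_real_derivative_neg_dec_right[OF this neg] obtain d where
    d: "d > 0" "\<And>h. 0 < h \<Longrightarrow> 0 + h \<in> ?I \<Longrightarrow> h < d \<Longrightarrow> \<phi> (0 + h) < \<phi> 0" by blast
  have "min (d / 2) s0 > 0" using d(1) \<open>s0 > 0\<close> by simp
  moreover have "min (d / 2) s0 < d" using d(1) by simp
  ultimately show False
    using d(2)[of "min (d / 2) s0"] nonneg[of "min (d / 2) s0"] zero by (simp add: \<phi>_def)
qed

lemma source_less_transport:
  fixes u v :: real
  assumes "u \<noteq> 0" "u * v \<le> 0" "\<bar>v\<bar> \<le> S * \<bar>u\<bar>"
    and H: "\<And>r. - S \<le> r \<Longrightarrow> r \<le> 0 \<Longrightarrow>
      (\<gamma> - 1) * \<bar>\<alpha>\<bar> * \<bar>r\<^sup>2 - 1\<bar> < 2 * \<beta> * (\<gamma> + 1 + (3 - \<gamma>) * r)"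
    and "\<gamma> > 1"
  shows "\<bar>(\<gamma> - 1) / 8 * \<alpha> * (v\<^sup>2 - u\<^sup>2)\<bar> < \<beta> * (speed1 \<gamma> u v * u)"
proof -
  define r where "r = v / u"
  have v: "v = r * u" using \<open>u \<noteq> 0\<close> by (simp add: r_def)
  have "r \<le> 0" using assms(1,2) by (auto simp: r_def divide_le_0_iff mult_le_0_iff)
  have "\<bar>r\<bar> \<le> S" using assms(1,3) by (simp add: r_def field_simps abs_mult)
  then have "- S \<le> r" by simp
  from H[OF this \<open>r \<le> 0\<close>] have "(\<gamma> - 1) * \<bar>\<alpha>\<bar> * \<bar>r\<^sup>2 - 1\<bar> * (u\<^sup>2 / 8)
      < 2 * \<beta> * (\<gamma> + 1 + (3 - \<gamma>) * r) * (u\<^sup>2 / 8)"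
    using \<open>u \<noteq> 0\<close> by (intro mult_strict_right_mono) auto
  also have "2 * \<beta> * (\<gamma> + 1 + (3 - \<gamma>) * r) * (u\<^sup>2 / 8) = \<beta> * (speed1 \<gamma> u v * u)"
    by (simp add: v speed1_def power2_eq_square field_simps)
  finally have "(\<gamma> - 1) * \<bar>\<alpha>\<bar> * \<bar>r\<^sup>2 - 1\<bar> * (u\<^sup>2 / 8) < \<beta> * (speed1 \<gamma> u v * u)" .
  moreover have "v\<^sup>2 - u\<^sup>2 = (r\<^sup>2 - 1) * u\<^sup>2" by (simp add: v power2_eq_square algebra_simps)
  then have "\<bar>(\<gamma> - 1) / 8 * \<alpha> * (v\<^sup>2 - u\<^sup>2)\<bar> = (\<gamma> - 1) * \<bar>\<alpha>\<bar> * \<bar>r\<^sup>2 - 1\<bar> * (u\<^sup>2 / 8)"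
    using \<open>\<gamma> > 1\<close> by (simp add: abs_mult)
  ultimately show ?thesis by simp
qed

text \<open>The weight \<open>G\<close> is \<open>E\<close> or \<open>-1/E\<close>; both have derivative \<open>abar * \<bar>G\<bar>\<close>.\<close>

lemma no_first_contact:
  fixes u :: "real \<times> real \<Rightarrow> real"
  assumes u: "(u has_derivative (\<lambda>(h, k). ux * h + ut * k)) (at (x, t) within {0..} \<times> {0..T})"
    and eq: "ut + speed1 \<gamma> (u (x, t)) v * ux = src"
    and src: "\<bar>src\<bar> < \<beta> * (speed1 \<gamma> (u (x, t)) v * u (x, t))"
    and G: "(G has_real_derivative \<beta> * \<bar>G x\<bar>) (at x within {0..})" and "G x \<noteq> 0"
    and xt: "0 \<le> x" "0 < t" "t \<le> T" "x \<le> X - M * t"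
    and speed: "\<bar>speed1 \<gamma> (u (x, t)) v\<bar> \<le> M"
    and bdry: "x = 0 \<Longrightarrow> speed1 \<gamma> (u (x, t)) v \<le> 0"
    and nonneg: "\<And>y s. 0 \<le> y \<Longrightarrow> 0 \<le> s \<Longrightarrow> s < t \<Longrightarrow> y \<le> X - M * s \<Longrightarrow> 0 \<le> u (y, s) * G y + c"
    and zero: "u (x, t) * G x + c = 0"
  shows False
proof -
  define \<mu> where "\<mu> = speed1 \<gamma> (u (x, t)) v"
  obtain s0 where s0: "s0 > 0" "s0 \<le> t" "\<And>s. 0 \<le> s \<Longrightarrow> s \<le> s0 \<Longrightarrow> 0 \<le> x - \<mu> * s"
  proof (cases "\<mu> \<le> 0")
    case True
    show thesis
    proof (rule that[of t])
      fix s :: real assume "0 \<le> s"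
      with True have "\<mu> * s \<le> 0" by (rule mult_nonpos_nonneg)
      with xt show "0 \<le> x - \<mu> * s" by simp
    qed (use xt in auto)
  next
    case False
    with bdry have "x \<noteq> 0" by (auto simp: \<mu>_def)
    with xt have "x > 0" by simp
    show thesis
    proof (rule that[of "min t (x / \<mu>)"])
      fix s assume "s \<le> min t (x / \<mu>)"
      then show "0 \<le> x - \<mu> * s" using False by (simp add: field_simps)
    qed (use False \<open>x > 0\<close> xt in auto)
  qed
  have "(ut + \<mu> * ux) * G x + \<mu> * u (x, t) * (\<beta> * \<bar>G x\<bar>) \<le> 0"
  proof (rule derivative_along_first_contact[OF u G s0(1) _ _ _ zero])
    fix s assume s: "0 < s" "s \<le> s0"
    have "- \<mu> * s \<le> M * s" using s speed by (intro mult_right_mono) (auto simp: \<mu>_def)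
    with s s0(2) s0(3)[of s] xt show "0 \<le> u (x - \<mu> * s, t - s) * G (x - \<mu> * s) + c"
      by (intro nonneg) (auto simp: algebra_simps)
  qed (use s0 xt in auto)
  moreover have "\<bar>src * G x\<bar> < \<mu> * u (x, t) * (\<beta> * \<bar>G x\<bar>)"
    using mult_strict_right_mono[OF src, of "\<bar>G x\<bar>"] \<open>G x \<noteq> 0\<close>
    by (simp add: \<mu>_def abs_mult mult_ac)
  ultimately show False using eq by (auto simp: \<mu>_def)
qed

lemma speed2_eq_speed1: "speed2 \<gamma> z w = speed1 \<gamma> w z"
  by (simp add: speed1_def speed2_def)

lemma strict_invariance_on_cone:
  fixes z w :: "real \<times> real \<Rightarrow> real" and E abar a :: "real \<Rightarrow> real"
  assumes "1 < \<gamma>" and M: "M \<ge> 0" and "1 \<le> S"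
    and pos: "0 < L1" "0 < L2" "0 < U1" "0 < U2"
    and E: "\<And>x. x \<ge> 0 \<Longrightarrow> (E has_real_derivative abar x * E x) (at x within {0..})"
    and E1: "\<And>x. x \<ge> 0 \<Longrightarrow> 1 \<le> E x" and E0: "E 0 = 1"
    and UL: "\<And>x. x \<ge> 0 \<Longrightarrow> U1 * (E x)\<^sup>2 \<le> L1"
    and le: "U2 \<le> S * U1" "L1 \<le> S * L2" "L1 \<le> U2" "L2 \<le> U1"
    and H: "\<And>x r. 0 \<le> x \<Longrightarrow> x \<le> X \<Longrightarrow> - S \<le> r \<Longrightarrow> r \<le> 0 \<Longrightarrow>
      (\<gamma> - 1) * \<bar>a x\<bar> * \<bar>r\<^sup>2 - 1\<bar> < 2 * abar x * (\<gamma> + 1 + (3 - \<gamma>) * r)"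
    and z: "C1_on_with2 ({0..} \<times> {0..T}) z zx zt" and w: "C1_on_with2 ({0..} \<times> {0..T}) w wx wt"
    and eqz: "\<And>x t. x \<ge> 0 \<Longrightarrow> t \<in> {0..T} \<Longrightarrow>
      zt (x, t) + speed1 \<gamma> (z (x, t)) (w (x, t)) * zx (x, t)
        = (\<gamma> - 1) / 8 * a x * ((w (x, t))\<^sup>2 - (z (x, t))\<^sup>2)"
    and eqw: "\<And>x t. x \<ge> 0 \<Longrightarrow> t \<in> {0..T} \<Longrightarrow>
      wt (x, t) + speed2 \<gamma> (z (x, t)) (w (x, t)) * wx (x, t)
        = - ((\<gamma> - 1) / 8 * a x * ((w (x, t))\<^sup>2 - (z (x, t))\<^sup>2))"
    and bdry: "\<And>t. t \<in> {0..T} \<Longrightarrow> w (0, t) + z (0, t) = 0"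
    and speed: "\<And>x t. x \<ge> 0 \<Longrightarrow> t \<in> {0..T} \<Longrightarrow>
      \<bar>speed1 \<gamma> (z (x, t)) (w (x, t))\<bar> \<le> M \<and> \<bar>speed2 \<gamma> (z (x, t)) (w (x, t))\<bar> \<le> M"
    and init: "\<And>x. x \<ge> 0 \<Longrightarrow> - L1 < z (x, 0) * E x \<and> z (x, 0) < - U1 * E x \<and>
      L2 < w (x, 0) * E x \<and> w (x, 0) < U2 * E x"
    and xt: "0 \<le> x" "t \<in> {0..T}" "x \<le> X - M * t"
  shows "- L1 < z (x, t) * E x \<and> z (x, t) < - U1 * E x \<and>
    L2 < w (x, t) * E x \<and> w (x, t) < U2 * E x"
proof -
  define P1 where "P1 p = z p * E (fst p) + L1" for p
  define P2 where "P2 p = z p * (- 1 / E (fst p)) + - U1" for p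
  define P3 where "P3 p = w p * E (fst p) + - L2" for p
  define P4 where "P4 p = w p * (- 1 / E (fst p)) + U2" for p
  define m where "m p = min (min (P1 p) (P2 p)) (min (P3 p) (P4 p))" for p
  define K where "K = {p::real \<times> real. 0 \<le> fst p \<and> 0 \<le> snd p \<and> snd p \<le> T \<and> fst p \<le> X - M * snd p}"
  have Epos: "E x > 0" if "x \<ge> 0" for x using E1[OF that] by simp
  have m_pos: "m (x, t) > 0 \<longleftrightarrow> - L1 < z (x, t) * E x \<and> z (x, t) < - U1 * E x \<and>
      L2 < w (x, t) * E x \<and> w (x, t) < U2 * E x" if "x \<ge> 0" for x t
    using Epos[OF that] by (auto simp: m_def P1_def P2_def P3_def P4_def field_simps)
  have leX: "y \<le> X" if "y \<le> X - M * s" "0 \<le> s" for y s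
    using that mult_nonneg_nonneg[OF M, of s] by linarith
  then have "K \<subseteq> {0..X} \<times> {0..T}" by (auto simp: K_def)
  moreover have "closed K" unfolding K_def
    by (intro closed_Collect_conj closed_Collect_le continuous_intros)
  ultimately have K: "compact K"
    using bounded_subset[OF bounded_Times[OF bounded_closed_interval bounded_closed_interval]]
    by (simp add: compact_eq_bounded_closed)
  have KT: "K \<subseteq> {0..} \<times> {0..T}" by (auto simp: K_def)
  have contE: "continuous_on {0..} E"
    by (rule DERIV_continuous_on[OF E]) simp
  have contE': "continuous_on K (\<lambda>p. E (fst p))"
    by (rule continuous_on_compose2[OF contE]) (auto simp: K_def intro!: continuous_intros)
  have cont: "continuous_on K u" if "C1_on_with2 ({0..} \<times> {0..T}) u ux ut" for u ux ut
    using that by (intro continuous_on_subset[OF _ KT]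
      has_derivative_continuous_on[where f' = "\<lambda>p (h, k). ux p * h + ut p * k"])
      (auto simp: C1_on_with2_def)
  have contm: "continuous_on K m"
    unfolding m_def P1_def P2_def P3_def P4_def
    by (intro continuous_intros contE' cont[OF z] cont[OF w])
      (use Epos in \<open>force simp: K_def\<close>)+
  define B where "B = {p \<in> K. m p \<le> 0}"
  have "m (x, t) > 0"
  proof (rule ccontr)
    assume "\<not> m (x, t) > 0"
    with xt have "(x, t) \<in> B" by (simp add: B_def K_def)
    then have "B \<noteq> {}" by blast
    moreover have "compact B"
    proof -
      have "closed B" unfolding B_def
        using continuous_on_closed_Collect_le[OF contm continuous_on_const compact_imp_closed[OF K]] .
      then show ?thesis using compact_Int_closed[OF K, of B] by (simp add: B_def Int_absorb1 Collect_conj_eq)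
    qed
    ultimately obtain p where p: "p \<in> B" "\<And>q. q \<in> B \<Longrightarrow> snd p \<le> snd q"
      using continuous_attains_inf[of B snd, OF _ _ continuous_on_snd[OF continuous_on_id]]
      by blast
    obtain y s where ys: "p = (y, s)" by force
    have y: "0 \<le> y" "0 \<le> s" "s \<le> T" "y \<le> X - M * s" and my: "m (y, s) \<le> 0"
      using p(1) by (auto simp: ys B_def K_def)
    have "s \<noteq> 0" using m_pos[OF y(1)] init[OF y(1)] my by force
    then have "s > 0" using y by simp
    have before: "m (y', s') > 0" if "0 \<le> y'" "0 \<le> s'" "s' < s" "y' \<le> X - M * s'" for y' s'
      using p(2)[of "(y', s')"] that y by (force simp: ys B_def K_def)
    have "m (y, s) \<ge> 0"
    proof -
      have sub: "(y, s') \<in> K" if "s' \<in> {0..s}" for s'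
        using that mult_left_mono[of s' s, OF _ M] y by (auto simp: K_def)
      have "continuous_on {0..s} (\<lambda>s'. m (y, s'))"
        by (rule continuous_on_compose2[OF contm]) (use sub in \<open>auto intro!: continuous_intros\<close>)
      moreover have "m (y, s') \<ge> 0" if "s' \<in> {0<..<s}" for s'
        using before[of y s'] sub[of s'] that by (simp add: K_def)
      ultimately show ?thesis
        using continuous_ge_on_closure[of "{0<..<s}" "\<lambda>s'. m (y, s')" s 0] \<open>s > 0\<close> by simp
    qed
    then have nn: "P1 (y, s) \<ge> 0" "P2 (y, s) \<ge> 0" "P3 (y, s) \<ge> 0" "P4 (y, s) \<ge> 0"
      by (auto simp: m_def)
    let ?e = "E y" and ?z = "z (y, s)" and ?w = "w (y, s)"
    have e: "?e \<ge> 1" and e0: "?e > 0" using E1 Epos y by auto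
    have ineq: "?z * ?e \<ge> - L1" "?z \<le> - U1 * ?e" "?w * ?e \<ge> L2" "?w \<le> U2 * ?e"
      using nn e0 by (auto simp: P1_def P2_def P3_def P4_def field_simps)
    have zneg: "?z < 0" using ineq(2) mult_pos_pos[OF pos(3) e0] by simp
    have "0 < ?w * ?e" using ineq(3) pos by simp
    then have wpos: "?w > 0" using e0 by (simp add: zero_less_mult_iff)
    note H' = H[OF y(1) leX[OF y(4,2)]]
    have dE: "((\<lambda>x. E x) has_real_derivative abar y * \<bar>E y\<bar>) (at y within {0..})"
      using E[OF y(1)] e0 by simp
    have dE': "((\<lambda>x. - 1 / E x) has_real_derivative abar y * \<bar>- 1 / E y\<bar>) (at y within {0..})"
      by (rule derivative_eq_intros E[OF y(1)] refl)+
        (use e0 in \<open>auto simp: field_simps power2_eq_square\<close>)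
    have dz: "(z has_derivative (\<lambda>(h, k). zx (y, s) * h + zt (y, s) * k))
        (at (y, s) within {0..} \<times> {0..T})"
      and dw: "(w has_derivative (\<lambda>(h, k). wx (y, s) * h + wt (y, s) * k))
        (at (y, s) within {0..} \<times> {0..T})"
      using z w y by (auto simp: C1_on_with2_def)
    have sz: "\<bar>speed1 \<gamma> ?z ?w\<bar> \<le> M" and sw: "\<bar>speed1 \<gamma> ?w ?z\<bar> \<le> M"
      using speed[of y s] y by (auto simp: speed2_eq_speed1)
    have bz: "speed1 \<gamma> ?z ?w \<le> 0" if "y = 0"
    proof -
      have "?z = - ?w" using bdry[of s] y that by auto
      then have "speed1 \<gamma> ?z ?w = - ((\<gamma> - 1) / 2 * ?w)" by (simp add: speed1_def field_simps)
      then show ?thesis using wpos \<open>1 < \<gamma>\<close> by simp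
    qed
    have eqz': "zt (y, s) + speed1 \<gamma> ?z ?w * zx (y, s) = (\<gamma> - 1) / 8 * a y * (?w\<^sup>2 - ?z\<^sup>2)"
      using eqz y by simp
    have eqw': "wt (y, s) + speed1 \<gamma> ?w ?z * wx (y, s) = (\<gamma> - 1) / 8 * a y * (?z\<^sup>2 - ?w\<^sup>2)"
      using eqw[of y s] y by (simp add: speed2_eq_speed1 algebra_simps)
    have srcz: "\<bar>(\<gamma> - 1) / 8 * a y * (?w\<^sup>2 - ?z\<^sup>2)\<bar> < abar y * (speed1 \<gamma> ?z ?w * ?z)"
      if "?w \<le> S * - ?z"
      using zneg wpos that H' \<open>1 < \<gamma>\<close>
      by (intro source_less_transport[where S = S]) (auto intro: mult_nonpos_nonneg less_imp_le)
    have srcw: "\<bar>(\<gamma> - 1) / 8 * a y * (?z\<^sup>2 - ?w\<^sup>2)\<bar> < abar y * (speed1 \<gamma> ?w ?z * ?w)"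
      if "- ?z \<le> S * ?w"
      using zneg wpos that H' \<open>1 < \<gamma>\<close>
      by (intro source_less_transport[where S = S]) (auto intro: mult_nonneg_nonpos less_imp_le)
    have c1: False if "P1 (y, s) = 0"
    proof (rule no_first_contact[OF dz eqz' srcz dE _ y(1) \<open>s > 0\<close> y(3,4) sz bz])
      have "U1 * (?w * ?e) \<le> U1 * (U2 * ?e * ?e)" using ineq pos e0 by (intro mult_left_mono mult_right_mono) auto
      also have "\<dots> = U2 * (U1 * ?e\<^sup>2)" by (simp add: power2_eq_square)
      also have "\<dots> \<le> S * U1 * L1" using UL[OF y(1)] le pos e0 by (intro mult_mono) auto
      also have "\<dots> = U1 * (S * - ?z * ?e)" using that by (simp add: P1_def) algebra
      finally have "(U1 * ?e) * ?w \<le> (U1 * ?e) * (S * - ?z)" by (simp only: mult_ac)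
      then show "?w \<le> S * - ?z" by (rule mult_left_le_imp_le) (use pos e0 in simp)
      show "?z * ?e + L1 = 0" using that by (simp add: P1_def)
      show "0 \<le> z (y', s') * E y' + L1" if "0 \<le> y'" "0 \<le> s'" "s' < s" "y' \<le> X - M * s'" for y' s'
        using before[OF that] by (simp add: m_def P1_def)
    qed (use e0 in auto)
    have c2: False if "P2 (y, s) = 0"
    proof (rule no_first_contact[OF dz eqz' srcz dE' _ y(1) \<open>s > 0\<close> y(3,4) sz bz])
      have "?w \<le> (S * U1) * ?e"
        by (rule order_trans[OF ineq(4) mult_right_mono[OF le(1)]]) (use e0 in simp)
      also have "\<dots> = S * - ?z"
      proof -
        have "- ?z = U1 * ?e" using that e0 by (simp add: P2_def field_simps)
        then show ?thesis by (simp only: mult.assoc)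
      qed
      finally show "?w \<le> S * - ?z" .
      show "?z * (- 1 / ?e) + - U1 = 0" using that by (simp add: P2_def)
      show "0 \<le> z (y', s') * (- 1 / E y') + - U1"
        if "0 \<le> y'" "0 \<le> s'" "s' < s" "y' \<le> X - M * s'" for y' s'
        using before[OF that] by (simp add: m_def P2_def)
    qed (use e0 in auto)
    have c3: False if P: "P3 (y, s) = 0"
    proof (cases "y = 0")
      case True
      then have "P2 (y, s) \<le> 0" using P bdry[of s] y le E0 by (auto simp: P3_def P2_def)
      with c2 nn show False by auto
    next
      case False
      show False
      proof (rule no_first_contact[OF dw eqw' srcw dE _ y(1) \<open>s > 0\<close> y(3,4) sw])
        have "- ?z * ?e \<le> S * (?w * ?e)" using ineq le P by (simp add: P3_def)
        then have "- ?z * ?e \<le> (S * ?w) * ?e" by (simp only: mult.assoc)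
        then show "- ?z \<le> S * ?w" by (rule mult_right_le_imp_le) (rule e0)
        show "?w * ?e + - L2 = 0" using P by (simp add: P3_def)
        show "0 \<le> w (y', s') * E y' + - L2"
          if "0 \<le> y'" "0 \<le> s'" "s' < s" "y' \<le> X - M * s'" for y' s'
          using before[OF that] by (simp add: m_def P3_def)
      qed (use e0 False in auto)
    qed
    have c4: False if P: "P4 (y, s) = 0"
    proof (cases "y = 0")
      case True
      then have "P1 (y, s) \<le> 0" using P bdry[of s] y le E0 by (auto simp: P4_def P1_def)
      with c1 nn show False by auto
    next
      case False
      show False
      proof (rule no_first_contact[OF dw eqw' srcw dE' _ y(1) \<open>s > 0\<close> y(3,4) sw])
        have "- ?z \<le> - ?z * ?e" using mult_left_mono[OF e, of "- ?z"] zneg by simp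
        also have "\<dots> \<le> U2" using ineq le by simp
        also have "\<dots> \<le> U2 * ?e" using e pos by simp
        also have "\<dots> = ?w" using P e0 by (simp add: P4_def field_simps)
        also have "\<dots> \<le> S * ?w" using \<open>1 \<le> S\<close> wpos by simp
        finally show "- ?z \<le> S * ?w" .
        show "?w * (- 1 / ?e) + U2 = 0" using P by (simp add: P4_def)
        show "0 \<le> w (y', s') * (- 1 / E y') + U2"
          if "0 \<le> y'" "0 \<le> s'" "s' < s" "y' \<le> X - M * s'" for y' s'
          using before[OF that] by (simp add: m_def P4_def)
      qed (use e0 False in auto)
    qed
    have "P1 (y, s) = 0 \<or> P2 (y, s) = 0 \<or> P3 (y, s) = 0 \<or> P4 (y, s) = 0"
      using my nn by (auto simp: m_def min_le_iff_disj)
    with c1 c2 c3 c4 show False by blast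
  qed
  with m_pos[OF xt(1)] show ?thesis by simp
qed

text \<open>Ratios below \<open>-1\<close>: right-hand minus left-hand side is a concave quadratic in \<open>r\<close> there, positive
  at \<open>-1\<close> and zero at \<open>-\<sigma>\<close>.\<close>

lemma f_ratio_ge_l:
  assumes "1 < \<gamma>" "\<gamma> < 3" "is_l \<gamma> l" "is_sigma1 \<gamma> l \<sigma>" "- \<sigma> \<le> r" "r \<le> 0"
  shows "(\<gamma> - 1) * l * \<bar>r\<^sup>2 - 1\<bar> \<le> 2 * (\<gamma> + 1 + (3 - \<gamma>) * r)"
proof (cases "r > -1")
  case True
  then have "r\<^sup>2 < 1" using assms(6) by (simp add: abs_square_less_1 flip: abs_less_iff)
  have "ereal l \<le> f_ratio \<gamma> r" using assms True by (auto simp: is_l_def)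
  moreover have "\<bar>r\<^sup>2 - 1\<bar> = 1 - r\<^sup>2" using \<open>r\<^sup>2 < 1\<close> by simp
  ultimately have "l \<le> 2 * (\<gamma> + 1 + (3 - \<gamma>) * r) / ((\<gamma> - 1) * (1 - r\<^sup>2))"
    using assms True by (simp add: f_ratio_def split: if_splits)
  then show ?thesis
    using \<open>r\<^sup>2 < 1\<close> assms(1) \<open>\<bar>r\<^sup>2 - 1\<bar> = 1 - r\<^sup>2\<close> by (simp add: pos_le_divide_eq mult_ac)
next
  case False
  define N where "N r = 2 * (\<gamma> + 1 + (3 - \<gamma>) * r) - (\<gamma> - 1) * l * (r\<^sup>2 - 1)" for r
  have \<sigma>: "\<sigma> > 1" using assms(4) by (simp add: is_sigma1_def)
  then have "\<sigma>\<^sup>2 > 1" by simp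
  then have "\<bar>\<sigma>\<^sup>2 - 1\<bar> = \<sigma>\<^sup>2 - 1" "\<sigma>\<^sup>2 - 1 \<noteq> 0" by simp_all
  moreover from this have "l = 2 * (\<gamma> + 1 - (3 - \<gamma>) * \<sigma>) / ((\<gamma> - 1) * (\<sigma>\<^sup>2 - 1))"
    using assms(4) \<sigma> by (simp add: is_sigma1_def f_ratio_def)
  ultimately have N0: "N (- \<sigma>) = 0" using assms(1) by (simp add: N_def)
  have N1: "N (-1) = 4 * (\<gamma> - 1)" by (simp add: N_def)
  have "(\<sigma> - 1) * N r = (\<sigma> + r) * N (-1) + (-1 - r) * N (- \<sigma>)
      + (\<gamma> - 1) * l * ((\<sigma> - 1) * ((\<sigma> + r) * (-1 - r)))"
    unfolding N_def power2_eq_square by (simp add: algebra_simps)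
  also have "\<dots> \<ge> 0"
    using False \<sigma> assms by (simp add: N0 N1 is_l_def)
  finally have "N r \<ge> 0" using \<sigma> by (simp add: zero_le_mult_iff)
  moreover have "r\<^sup>2 \<ge> 1" using False by (simp add: abs_square_less_1 flip: not_less)
  ultimately show ?thesis by (simp add: N_def)
qed

lemma ratio_margin:
  assumes "1 < \<gamma>" "\<gamma> < 3" "is_l \<gamma> l" "is_sigma1 \<gamma> l \<sigma>" "0 \<le> k" "k < l"
  obtains S where "S > \<sigma>" "\<And>r. - S \<le> r \<Longrightarrow> r \<le> 0 \<Longrightarrow>
      (\<gamma> - 1) * k * \<bar>r\<^sup>2 - 1\<bar> < 2 * (\<gamma> + 1 + (3 - \<gamma>) * r)"
proof -
  define h where "h r = 2 * (\<gamma> + 1 + (3 - \<gamma>) * r) - (\<gamma> - 1) * k * \<bar>r\<^sup>2 - 1\<bar>" for r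
  have \<sigma>: "\<sigma> > 1" using assms(4) by (simp add: is_sigma1_def)
  have pos: "h r > 0" if r: "- \<sigma> \<le> r" "r \<le> 0" for r
  proof (cases "r = -1")
    case True
    then show ?thesis using assms by (simp add: h_def)
  next
    case False
    with r have "r\<^sup>2 \<noteq> 1" by (auto simp: power2_eq_1_iff)
    then have "(\<gamma> - 1) * k * \<bar>r\<^sup>2 - 1\<bar> < (\<gamma> - 1) * l * \<bar>r\<^sup>2 - 1\<bar>" using assms by simp
    then show ?thesis using f_ratio_ge_l[OF assms(1-4) r] by (simp add: h_def)
  qed
  have "isCont h (- \<sigma>)" unfolding h_def by (intro continuous_intros)
  then have "\<forall>\<^sub>F r in nhds (- \<sigma>). h r > 0"
    using pos[of "- \<sigma>"] \<sigma> order_tendstoD(1)[of h "h (- \<sigma>)" "nhds (- \<sigma>)" 0]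
    by (simp add: continuous_at tendsto_at_iff_tendsto_nhds)
  then obtain d where d: "d > 0" "\<And>r. dist r (- \<sigma>) < d \<Longrightarrow> h r > 0"
    by (auto simp: eventually_nhds_metric)
  show thesis
  proof (rule that[of "\<sigma> + d / 2"])
    fix r assume r: "- (\<sigma> + d / 2) \<le> r" "r \<le> 0"
    have "h r > 0"
      using d(2)[of r] pos[of r] r d(1) by (cases "- \<sigma> \<le> r") (auto simp: dist_real_def)
    then show "(\<gamma> - 1) * k * \<bar>r\<^sup>2 - 1\<bar> < 2 * (\<gamma> + 1 + (3 - \<gamma>) * r)" by (simp add: h_def)
  qed (use d in simp)
qed

lemma exp_integral_has_derivative:
  fixes f :: "real \<Rightarrow> real"
  assumes "continuous_on {0..} f" "x \<ge> 0"
  shows "((\<lambda>x. exp (integral {0..x} f)) has_real_derivative f x * exp (integral {0..x} f))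
    (at x within {0..})"
proof -
  have "((\<lambda>x. integral {0..x} f) has_real_derivative f x) (at x within {0..x+1})"
    using assms by (intro integral_has_real_derivative) (auto intro: continuous_on_subset)
  moreover have "at x within {0..x+1} = at x within {0..}"
    by (rule at_within_nhd[of x "{..<x+1}"]) auto
  ultimately show ?thesis by (auto intro!: derivative_eq_intros)
qed

lemma C1_on_with_continuous_on: "C1_on_with S f f' \<Longrightarrow> continuous_on S f"
  by (auto simp: C1_on_with_def intro: DERIV_continuous_on)

theorem proposition2p1:
  fixes \<gamma> l \<sigma>1 L1 L2 U1 U2 T :: real
    and A A' a abar z0 w0 :: "real \<Rightarrow> real"
    and z w :: "real \<times> real \<Rightarrow> real"
  assumes "1 < \<gamma>" and "\<gamma> \<le> 5 / 3"
    and "C2_on_with {0..} A A'" and "\<And>x. x \<ge> 0 \<Longrightarrow> A x > 0"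
    and "\<And>x. x \<ge> 0 \<Longrightarrow> a x = A' x / A x"
    and "is_l \<gamma> l" and "is_sigma1 \<gamma> l \<sigma>1"
    and "C1b_on {0..} abar" and "abar absolutely_integrable_on {0..}"
    and "L1 > 0" and "L2 > 0" and "U1 > 0" and "U2 > 0"
    and "\<And>x. x \<ge> 0 \<Longrightarrow> \<bar>a x\<bar> < l * abar x"
    and "U1 * exp (2 * integral {0..} abar) \<le> L1" and "L2 \<le> U2"
    and "(3 - \<gamma>) / (\<gamma> + 1) < L2 / L1" and "U2 / U1 < (\<gamma> + 1) / (3 - \<gamma>)"
    and "L1 / L2 \<le> \<sigma>1" and "U2 / U1 \<le> \<sigma>1"
    and "U2 \<ge> L1" and "U1 \<ge> L2"
    and "\<And>x. x \<ge> 0 \<Longrightarrow> (z0 x, w0 x) \<in> Delta_m abar L1 L2 U1 U2 x"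
    and "T > 0" and "P1_solution \<gamma> a z0 w0 T z w"
    and "\<And>x t. x \<ge> 0 \<Longrightarrow> t \<in> {0..T} \<Longrightarrow> w (x, t) \<ge> z (x, t)"
  shows "\<forall>x\<ge>0. \<forall>t\<in>{0..T}. (z (x, t), w (x, t)) \<in> Delta_m abar L1 L2 U1 U2 x"
proof (intro allI impI ballI)
  fix x t :: real assume x: "x \<ge> 0" and t: "t \<in> {0..T}"
  define E where "E = (\<lambda>x. exp (integral {0..x} abar))"
  have l: "l > 0" using assms(6) by (simp add: is_l_def)
  have abar: "abar x > 0" if "x \<ge> 0" for x
    using le_less_trans[OF abs_ge_zero assms(14)[OF that]] l by (simp add: zero_less_mult_iff)
  have cabar: "continuous_on {0..} abar"
    using assms(8) by (auto simp: C1b_on_def intro: C1_on_with_continuous_on)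
  have "continuous_on {0..} (\<lambda>x. A' x / A x)"
    using assms(3,4) by (intro continuous_on_divide)
      (force simp: C2_on_with_def intro: C1_on_with_continuous_on)+
  then have ca: "continuous_on {0..} a"
    by (rule continuous_on_eq) (simp add: assms(5))
  have int: "abar integrable_on {0..}"
    using assms(9) by (simp add: absolutely_integrable_on_def)
  have int': "abar integrable_on {0..x}" for x
    using cabar by (intro integrable_continuous_interval continuous_on_subset[OF cabar]) auto
  have E1: "E x \<ge> 1" for x
    using integral_nonneg[OF int'] abar by (force simp: E_def less_imp_le)
  have UL: "U1 * (E x)\<^sup>2 \<le> L1" for x
  proof -
    have "integral {0..x} abar \<le> integral {0..} abar"
      using abar by (intro integral_subset_le int int') (auto simp: less_imp_le)
    then have "(E x)\<^sup>2 \<le> exp (2 * integral {0..} abar)"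
      by (simp add: E_def flip: exp_double)
    then show ?thesis
      using assms(12,15) by (meson mult_left_mono less_imp_le order_trans)
  qed
  have Delta: "(u, v) \<in> Delta_m abar L1 L2 U1 U2 x \<longleftrightarrow>
      - L1 \<le> u * E x \<and> u \<le> - U1 * E x \<and> L2 \<le> v * E x \<and> v \<le> U2 * E x \<and> u \<le> v" for x u v
    using E1[of x] by (simp add: Delta_m_def E_def exp_minus field_simps)
  obtain zx zt wx wt where
    z: "C1_on_with2 ({0..} \<times> {0..T}) z zx zt" and w: "C1_on_with2 ({0..} \<times> {0..T}) w wx wt"
    and eqz: "\<And>x t. x \<ge> 0 \<Longrightarrow> t \<in> {0..T} \<Longrightarrow>
      zt (x, t) + speed1 \<gamma> (z (x, t)) (w (x, t)) * zx (x, t)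
        = (\<gamma> - 1) / 8 * a x * ((w (x, t))\<^sup>2 - (z (x, t))\<^sup>2)"
    and eqw: "\<And>x t. x \<ge> 0 \<Longrightarrow> t \<in> {0..T} \<Longrightarrow>
      wt (x, t) + speed2 \<gamma> (z (x, t)) (w (x, t)) * wx (x, t)
        = - ((\<gamma> - 1) / 8 * a x * ((w (x, t))\<^sup>2 - (z (x, t))\<^sup>2))"
    using assms(25) unfolding P1_solution_def by blast
  have bz: "bounded (z ` ({0..} \<times> {0..T}))" and bw: "bounded (w ` ({0..} \<times> {0..T}))"
    and init: "\<And>x. x \<ge> 0 \<Longrightarrow> z (x, 0) = z0 x \<and> w (x, 0) = w0 x"
    and bdry: "\<And>t. t \<in> {0..T} \<Longrightarrow> w (0, t) + z (0, t) = 0"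
    using assms(25) unfolding P1_solution_def by blast+
  obtain B where B: "B > 0" "\<And>x t. x \<ge> 0 \<Longrightarrow> t \<in> {0..T} \<Longrightarrow> \<bar>z (x, t)\<bar> \<le> B \<and> \<bar>w (x, t)\<bar> \<le> B"
  proof -
    obtain b1 where b1: "b1 > 0" "\<forall>y\<in>z ` ({0..} \<times> {0..T}). norm y \<le> b1"
      using bz unfolding bounded_pos by blast
    obtain b2 where b2: "b2 > 0" "\<forall>y\<in>w ` ({0..} \<times> {0..T}). norm y \<le> b2"
      using bw unfolding bounded_pos by blast
    show thesis
      by (rule that[of "max b1 b2"]) (use b1 b2 in \<open>force simp: le_max_iff_disj\<close>)+
  qed
  have speed1: "\<bar>speed1 \<gamma> u v\<bar> \<le> B" if "\<bar>u\<bar> \<le> B" "\<bar>v\<bar> \<le> B" for u v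
  proof -
    have "\<bar>speed1 \<gamma> u v\<bar> \<le> (\<gamma> + 1) / 4 * \<bar>u\<bar> + (3 - \<gamma>) / 4 * \<bar>v\<bar>"
      unfolding speed1_def using assms(1,2) by (intro abs_triangle_ineq[THEN order_trans]) (simp add: abs_mult)
    also have "\<dots> \<le> (\<gamma> + 1) / 4 * B + (3 - \<gamma>) / 4 * B"
      using that assms(1,2) by (intro add_mono mult_left_mono) auto
    finally show ?thesis by (simp add: field_simps)
  qed
  have speed: "\<bar>speed1 \<gamma> (z (x, t)) (w (x, t))\<bar> \<le> B \<and> \<bar>speed2 \<gamma> (z (x, t)) (w (x, t))\<bar> \<le> B"
    if "x \<ge> 0" "t \<in> {0..T}" for x t
    using B(2)[OF that] speed1 by (simp add: speed2_eq_speed1)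
  define X where "X = x + B * t"
  have "X \<ge> 0" using x t B by (simp add: X_def)
  obtain k where k: "0 \<le> k" "k < l" "\<And>x. 0 \<le> x \<Longrightarrow> x \<le> X \<Longrightarrow> \<bar>a x\<bar> \<le> k * abar x"
  proof -
    have "continuous_on {0..X} (\<lambda>x. \<bar>a x\<bar> / abar x)"
      using abar by (intro continuous_intros continuous_on_subset[OF ca] continuous_on_subset[OF cabar])
        force+
    then obtain x1 where x1: "x1 \<in> {0..X}"
      "\<And>x. x \<in> {0..X} \<Longrightarrow> \<bar>a x\<bar> / abar x \<le> \<bar>a x1\<bar> / abar x1"
      using continuous_attains_sup[of "{0..X}" "\<lambda>x. \<bar>a x\<bar> / abar x"] \<open>X \<ge> 0\<close> by auto
    show thesis
    proof (rule that[of "\<bar>a x1\<bar> / abar x1"])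
      show "0 \<le> \<bar>a x1\<bar> / abar x1" "\<bar>a x1\<bar> / abar x1 < l"
        using x1(1) abar[of x1] assms(14)[of x1] by (auto simp: field_simps)
      fix x assume "0 \<le> x" "x \<le> X"
      with x1(2)[of x] abar[of x] show "\<bar>a x\<bar> \<le> \<bar>a x1\<bar> / abar x1 * abar x"
        by (simp add: pos_divide_le_eq)
    qed
  qed
  obtain S where S: "S > \<sigma>1" and S_less: "\<And>r. - S \<le> r \<Longrightarrow> r \<le> 0 \<Longrightarrow>
      (\<gamma> - 1) * k * \<bar>r\<^sup>2 - 1\<bar> < 2 * (\<gamma> + 1 + (3 - \<gamma>) * r)"
    using ratio_margin[of \<gamma> l \<sigma>1 k] assms(1,2,6,7) k by auto
  have H: "(\<gamma> - 1) * \<bar>a x\<bar> * \<bar>r\<^sup>2 - 1\<bar> < 2 * abar x * (\<gamma> + 1 + (3 - \<gamma>) * r)"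
    if "0 \<le> x" "x \<le> X" "- S \<le> r" "r \<le> 0" for x r
  proof -
    have "(\<gamma> - 1) * \<bar>a x\<bar> * \<bar>r\<^sup>2 - 1\<bar> \<le> (\<gamma> - 1) * (k * abar x) * \<bar>r\<^sup>2 - 1\<bar>"
      using k(3)[OF that(1,2)] assms(1) by (intro mult_right_mono mult_left_mono) auto
    also have "\<dots> = (\<gamma> - 1) * k * \<bar>r\<^sup>2 - 1\<bar> * abar x" by simp
    also have "\<dots> < 2 * (\<gamma> + 1 + (3 - \<gamma>) * r) * abar x"
      using S_less[OF that(3,4)] abar[OF that(1)] by (intro mult_strict_right_mono)
    finally show ?thesis by (simp add: mult_ac)
  qed
  have \<sigma>: "\<sigma>1 > 1" using assms(7) by (simp add: is_sigma1_def)
  have strict: "U2 < S * U1" "L1 < S * L2"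
    using S assms(10-13,19,20) by (simp_all add: pos_divide_le_eq) (smt (verit) mult_strict_right_mono)+
  have lim: "((\<lambda>\<delta>. c + d * \<delta>) \<longlongrightarrow> c) (at_right 0)" for c d :: real
    by (auto intro!: tendsto_eq_intros)
  have "\<forall>\<^sub>F \<delta> in at_right 0. \<delta> < U1 \<and> \<delta> < L2 \<and>
      U2 - S * U1 + (1 + S) * \<delta> < 0 \<and> L1 - S * L2 + (1 + S) * \<delta> < 0"
    using assms(11,12) strict
    by (intro eventually_conj order_tendstoD(2)[OF lim] order_tendstoD(2)[OF tendsto_ident_at]) auto
  then have "\<forall>\<^sub>F \<delta> in at_right 0. - (L1 + \<delta>) \<le> z (x, t) * E x \<and> z (x, t) \<le> - (U1 - \<delta>) * E x \<and>
      L2 - \<delta> \<le> w (x, t) * E x \<and> w (x, t) \<le> (U2 + \<delta>) * E x"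
    using eventually_at_right_less[of 0]
  proof eventually_elim
    case (elim \<delta>)
    have "- (L1 + \<delta>) < z (x, t) * E x \<and> z (x, t) < - (U1 - \<delta>) * E x \<and>
      L2 - \<delta> < w (x, t) * E x \<and> w (x, t) < (U2 + \<delta>) * E x"
    proof (rule strict_invariance_on_cone[OF assms(1) _ _ _ _ _ _ _ E1 _ _ _ _ _ _ H
            z w eqz eqw bdry speed _ x t])
      show "(E has_real_derivative abar x * E x) (at x within {0..})" if "x \<ge> 0" for x
        using exp_integral_has_derivative[OF cabar that] by (simp add: E_def)
      show "(U1 - \<delta>) * (E x)\<^sup>2 \<le> L1 + \<delta>" for x
        using UL[of x] mult_right_mono[of "U1 - \<delta>" U1 "(E x)\<^sup>2"] elim by simp
      show "- (L1 + \<delta>) < z (x, 0) * E x \<and> z (x, 0) < - (U1 - \<delta>) * E x \<and>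
        L2 - \<delta> < w (x, 0) * E x \<and> w (x, 0) < (U2 + \<delta>) * E x" if "x \<ge> 0" for x
      proof -
        have "\<delta> * E x > 0" using elim E1[of x] by simp
        moreover have "(z (x, 0), w (x, 0)) \<in> Delta_m abar L1 L2 U1 U2 x"
          using init[OF that] assms(23)[OF that] by simp
        ultimately show ?thesis using elim by (auto simp: Delta algebra_simps)
      qed
    qed (use elim assms(10-13,21,22) B S \<sigma> in \<open>auto simp: X_def E_def algebra_simps\<close>)
    then show ?case by auto
  qed
  then have ev: "\<forall>\<^sub>F \<delta> in at_right 0. - L1 + - 1 * \<delta> \<le> z (x, t) * E x"
    "\<forall>\<^sub>F \<delta> in at_right 0. z (x, t) \<le> - U1 * E x + E x * \<delta>"
    "\<forall>\<^sub>F \<delta> in at_right 0. L2 + - 1 * \<delta> \<le> w (x, t) * E x"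
    "\<forall>\<^sub>F \<delta> in at_right 0. w (x, t) \<le> U2 * E x + E x * \<delta>"
    by (eventually_elim; simp add: algebra_simps)+
  have "- L1 \<le> z (x, t) * E x" "z (x, t) \<le> - U1 * E x" "L2 \<le> w (x, t) * E x" "w (x, t) \<le> U2 * E x"
    using tendsto_upperbound[OF lim ev(1)] tendsto_lowerbound[OF lim ev(2)]
      tendsto_upperbound[OF lim ev(3)] tendsto_lowerbound[OF lim ev(4)]
    by simp_all
  then show "(z (x, t), w (x, t)) \<in> Delta_m abar L1 L2 U1 U2 x"
    using assms(26)[OF x t] by (simp add: Delta)
qed

end
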